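(* Let $K_c>0$, $\eta_c>0$, $I_d\ge 0$ be real numbers. Let the solar radiation intensity $I$ be a normal random variable with mean $I_d$ and variance $1$, with density $f_I(x)=\frac{1}{\sqrt{2\pi}}\exp\left(-\frac{(x-I_d)^2}{2}\right)$, and let the harvested solar power be $P=\frac{\eta_c}{K_c}I^2$ for $0<I<K_c$ and $P=\eta_c I$ for $I\ge K_c$. Then the probability density function of the harvested solar power $P$ is $$f_P(p)=\begin{cases}\dfrac12\sqrt{\dfrac{K_c}{\eta_c p}}\; f_I\!\left(\sqrt{\dfrac{K_c p}{\eta_c}}\right), & p<\eta_c K_c,\\[2mm] \dfrac{1}{\eta_c}\, f_I\!\left(\dfrac{p}{\eta_c}\right), & \text{otherwise}.\end{cases}$$
   Context: $I=I_d+\Delta I$ is the solar radiation intensity at a fixed time, where $I_d\ge 0$ is a deterministic fundamental intensity and $\Delta I\sim N(0,1)$ is a stochastic attenuation. The radiation intensity is regarded as nonnegative, and $P$ is specified only for $I>0$, so $p$ ranges over positive values. $K_c$ is a threshold radiation intensity beyond which the efficiency $\eta_c$ of the photovoltaic system is approximated as constant. *)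

theory Defs
  imports "HOL-Probability.Probability"
begin

lemma normal_density_unit_variance:
  "normal_density I\<^sub>d 1 x = 1 / sqrt (2 * pi) * exp (- (x - I\<^sub>d)\<^sup>2 / 2)"
  by (simp add: normal_density_def)

text \<open>Only the values at \<^term>\<open>p > (0::real)\<close> are meaningful.\<close>

definition solar_power_density :: "real \<Rightarrow> real \<Rightarrow> real \<Rightarrow> real \<Rightarrow> real" where
  "solar_power_density K\<^sub>c \<eta>\<^sub>c I\<^sub>d p =
    (if p < \<eta>\<^sub>c * K\<^sub>c
     then 1 / 2 * sqrt (K\<^sub>c / (\<eta>\<^sub>c * p)) * normal_density I\<^sub>d 1 (sqrt (K\<^sub>c * p / \<eta>\<^sub>c))
     else 1 / \<eta>\<^sub>c * normal_density I\<^sub>d 1 (p / \<eta>\<^sub>c))"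

end

theory Submission
  imports Defs
begin

text \<open>On the event \<open>I > 0\<close> the power is \<open>g(I)\<close> for an increasing bijection \<open>g\<close> of the positive half-line
  that is quadratic below \<open>K\<^sub>c\<close> and linear above. The density is the image of the normal density under
  \<open>g\<close>. Substituting \<open>p = g(x)\<close>, rather than using the inverse of \<open>g\<close>, keeps the integrand regular at
  the origin: the factor \<open>g'(x)\<close> cancels the singularity of the power density at \<open>p = 0\<close>.\<close>

definition solar_power :: "real \<Rightarrow> real \<Rightarrow> real \<Rightarrow> real" where
  "solar_power K \<eta> x = (if x < K then \<eta> / K * x\<^sup>2 else \<eta> * x)"

lemma solar_power_borel [measurable]: "solar_power K \<eta> \<in> borel_measurable borel"
  unfolding solar_power_def by measurable

lemma solar_power_density_borel [measurable]: "solar_power_density K \<eta> m \<in> borel_measurable borel"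
  unfolding solar_power_density_def by measurable

lemma solar_power_pos:
  assumes "K > 0" "\<eta> > 0" "x > 0"
  shows "solar_power K \<eta> x > 0"
  using assms by (simp add: solar_power_def)

lemma solar_power_density_nonneg:
  assumes "K > 0" "\<eta> > 0" "p > 0"
  shows "solar_power_density K \<eta> m p \<ge> 0"
  using assms by (simp add: solar_power_density_def)

text \<open>At \<open>p = \<eta> / K * x\<^sup>2\<close> the prefactor
  \<open>1 / 2 * sqrt (K / (\<eta> * p))\<close> equals \<open>K / (2 * \<eta> * x)\<close>, the
  reciprocal of the derivative of the quadratic branch, and the argument of the normal density
  becomes \<open>x\<close>.\<close>

lemma solar_power_density_quadratic:
  assumes "K > 0" "\<eta> > 0" "0 < x" "x < K"
  shows "solar_power_density K \<eta> m (\<eta> / K * x\<^sup>2) * (2 * \<eta> / K * x) = normal_density m 1 x"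
proof -
  have "x\<^sup>2 < K\<^sup>2"
    using assms by (intro power_strict_mono) auto
  then have "\<eta> / K * x\<^sup>2 < \<eta> * K"
    using assms by (simp add: field_simps power2_eq_square)
  moreover have "sqrt (K / (\<eta> * (\<eta> / K * x\<^sup>2))) = K / (\<eta> * x)"
    using assms by (intro real_sqrt_unique) (simp_all add: field_simps power2_eq_square)
  moreover have "sqrt (K * (\<eta> / K * x\<^sup>2) / \<eta>) = x"
    using assms by simp
  ultimately show ?thesis
    using assms by (simp add: solar_power_density_def field_simps)
qed

lemma nn_integral_solar_power_quadratic:
  fixes H :: "real \<Rightarrow> ennreal"
  assumes [measurable]: "H \<in> borel_measurable borel" and "K > 0" "\<eta> > 0"
  shows "(\<integral>\<^sup>+p. H p * ennreal (solar_power_density K \<eta> m p) * indicator {0<..<\<eta> * K} p \<partial>lborel) =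
    (\<integral>\<^sup>+x. H (solar_power K \<eta> x) * ennreal (normal_density m 1 x) * indicator {0<..<K} x \<partial>lborel)"
    (is "?L = ?R")
proof -
  define F where "F p = H p * ennreal (solar_power_density K \<eta> m p)" for p
  define g where "g x = \<eta> / K * x\<^sup>2" for x
  have [measurable]: "F \<in> borel_measurable borel"
    unfolding F_def by measurable
  \<comment> \<open>The substitution rule works on the closed interval from \<open>g 0 = 0\<close>
    to \<open>g K = \<eta> * K\<close>; the two added endpoints form a null set.\<close>
  have "AE p in lborel. F p * indicator {0<..<\<eta> * K} p = F p * indicator {g 0..g K} p"
    using AE_lborel_singleton[of 0] AE_lborel_singleton[of "\<eta> * K"]
    by eventually_elim (use assms in \<open>auto simp: indicator_def g_def power2_eq_square\<close>)
  then have "?L = (\<integral>\<^sup>+p. F p * indicator {g 0..g K} p \<partial>lborel)"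
    unfolding F_def by (rule nn_integral_cong_AE)
  also have "\<dots> = (\<integral>\<^sup>+x. F (g x) * ennreal (2 * \<eta> / K * x) * indicator {0..K} x \<partial>lborel)"
  proof (rule nn_integral_substitution_aux)
    show "(g has_real_derivative 2 * \<eta> / K * x) (at x)" for x
      using assms unfolding g_def by (auto intro!: derivative_eq_intros)
  qed (use assms in \<open>auto intro!: continuous_intros\<close>)
  also have "\<dots> = ?R"
  proof (rule nn_integral_cong_AE)
    \<comment> \<open>Only almost everywhere: at \<open>x = K\<close> the left indicator is 1 and
      the right one is 0.\<close>
    show "AE x in lborel. F (g x) * ennreal (2 * \<eta> / K * x) * indicator {0..K} x =
      H (solar_power K \<eta> x) * ennreal (normal_density m 1 x) * indicator {0<..<K} x"
      using AE_lborel_singleton[of 0] AE_lborel_singleton[of K]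
    proof eventually_elim
      case (elim x)
      show ?case
      proof (cases "0 < x \<and> x < K")
        case True
        then have "ennreal (solar_power_density K \<eta> m (g x)) * ennreal (2 * \<eta> / K * x) =
            ennreal (normal_density m 1 x)"
          using assms solar_power_density_quadratic[of K \<eta> x m]
          by (subst ennreal_mult[symmetric]) (auto simp: g_def intro!: solar_power_density_nonneg)
        with True show ?thesis
          by (simp add: F_def g_def solar_power_def mult.assoc)
      qed (use elim in \<open>auto simp: indicator_def\<close>)
    qed
  qed
  finally show ?thesis .
qed

text \<open>The scaling \<open>p = \<eta> * x\<close> contributes the Jacobian \<eta>, which cancels
  the factor \<open>1 / \<eta>\<close> of the density. Both the density and
  \<open>solar_power\<close> take their linear branch at the cut point itself, so the integrands
  agree pointwise and no null set is discarded.\<close>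

lemma nn_integral_solar_power_linear:
  fixes H :: "real \<Rightarrow> ennreal"
  assumes [measurable]: "H \<in> borel_measurable borel" and "K > 0" "\<eta> > 0"
  shows "(\<integral>\<^sup>+p. H p * ennreal (solar_power_density K \<eta> m p) * indicator {\<eta> * K..} p \<partial>lborel) =
    (\<integral>\<^sup>+x. H (solar_power K \<eta> x) * ennreal (normal_density m 1 x) * indicator {K..} x \<partial>lborel)"
    (is "?L = ?R")
proof -
  have "?L = ennreal \<bar>\<eta>\<bar> * (\<integral>\<^sup>+x. H (0 + \<eta> * x) *
      ennreal (solar_power_density K \<eta> m (0 + \<eta> * x)) * indicator {\<eta> * K..} (0 + \<eta> * x) \<partial>lborel)"
    using assms by (intro nn_integral_real_affine) auto
  also have "\<dots> = (\<integral>\<^sup>+x. ennreal \<eta> * (H (\<eta> * x) *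
      ennreal (solar_power_density K \<eta> m (\<eta> * x)) * indicator {\<eta> * K..} (\<eta> * x)) \<partial>lborel)"
    using assms by (subst nn_integral_cmult) auto
  also have "\<dots> = ?R"
  proof (rule nn_integral_cong)
    fix x
    show "ennreal \<eta> * (H (\<eta> * x) * ennreal (solar_power_density K \<eta> m (\<eta> * x)) *
        indicator {\<eta> * K..} (\<eta> * x)) =
      H (solar_power K \<eta> x) * ennreal (normal_density m 1 x) * indicator {K..} x"
    proof (cases "K \<le> x")
      case True
      then have "ennreal \<eta> * ennreal (solar_power_density K \<eta> m (\<eta> * x)) =
          ennreal (normal_density m 1 x)"
        using assms by (subst ennreal_mult'[symmetric]) (auto simp: solar_power_density_def)
      with True assms show ?thesis
        by (simp add: solar_power_def mult.left_commute[of "ennreal \<eta>"])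
    qed (use assms in \<open>auto simp: indicator_def\<close>)
  qed
  finally show ?thesis .
qed

text \<open>The two branches are glued at the corresponding cuts \<open>x = K\<close> and
  \<open>p = \<eta> * K\<close>. Taking \<open>H\<close> to be an indicator turns this into an
  equality of measures.\<close>

lemma nn_integral_solar_power:
  fixes H :: "real \<Rightarrow> ennreal"
  assumes [measurable]: "H \<in> borel_measurable borel" and "K > 0" "\<eta> > 0"
  shows "(\<integral>\<^sup>+p. H p * ennreal (solar_power_density K \<eta> m p) * indicator {0<..} p \<partial>lborel) =
    (\<integral>\<^sup>+x. H (solar_power K \<eta> x) * ennreal (normal_density m 1 x) * indicator {0<..} x \<partial>lborel)"
proof -
  have split: "(\<integral>\<^sup>+x. F x * indicator {0<..} x \<partial>lborel) =
      (\<integral>\<^sup>+x. F x * indicator {0<..<c} x \<partial>lborel) + (\<integral>\<^sup>+x. F x * indicator {c..} x \<partial>lborel)"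
    if [measurable]: "F \<in> borel_measurable borel" and "c > 0" for F :: "real \<Rightarrow> ennreal" and c
    using \<open>c > 0\<close> by (subst nn_integral_add[symmetric])
      (auto intro!: nn_integral_cong simp: indicator_def)
  show ?thesis
    using assms
    by (subst split[where c = "\<eta> * K"], simp, simp, subst split[where c = K])
      (simp_all add: nn_integral_solar_power_quadratic nn_integral_solar_power_linear)
qed

(* P is unspecified where I <= 0, so its distribution is taken over the event I > 0 and lives on
   the positive half-line. restrict_space does not renormalise: the conclusion says that
   Pr (I > 0 and P in A) is the integral of the density over A for every Borel set A of positive
   reals, and the total mass is Pr (I > 0). *)
theorem theorem1:
  fixes M :: "'a measure" and I P :: "'a \<Rightarrow> real" and K\<^sub>c \<eta>\<^sub>c I\<^sub>d :: real
  assumes "prob_space M"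
    and "K\<^sub>c > 0" and "\<eta>\<^sub>c > 0" and "I\<^sub>d \<ge> 0"
    and "distributed M lborel I (\<lambda>x. ennreal (normal_density I\<^sub>d 1 x))"
    and "\<And>\<omega>. \<omega> \<in> space M \<Longrightarrow> 0 < I \<omega> \<Longrightarrow> I \<omega> < K\<^sub>c \<Longrightarrow> P \<omega> = \<eta>\<^sub>c / K\<^sub>c * (I \<omega>)\<^sup>2"
    and "\<And>\<omega>. \<omega> \<in> space M \<Longrightarrow> K\<^sub>c \<le> I \<omega> \<Longrightarrow> P \<omega> = \<eta>\<^sub>c * I \<omega>"
  shows "distributed (restrict_space M {\<omega> \<in> space M. 0 < I \<omega>}) (restrict_space lborel {0<..}) P
           (\<lambda>p. ennreal (solar_power_density K\<^sub>c \<eta>\<^sub>c I\<^sub>d p))"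
proof -
  let ?\<Omega> = "{\<omega> \<in> space M. 0 < I \<omega>}"
  let ?M = "restrict_space M ?\<Omega>" and ?N = "restrict_space lborel {0<..} :: real measure"
  let ?g = "solar_power K\<^sub>c \<eta>\<^sub>c"
  let ?S = "\<lambda>p. ennreal (solar_power_density K\<^sub>c \<eta>\<^sub>c I\<^sub>d p)"
  have [measurable]: "I \<in> borel_measurable M"
    using distributed_measurable[OF assms(5)] by simp
  have \<Omega>: "?\<Omega> \<in> sets M"
    by measurable
  have space_M: "space ?M = ?\<Omega>"
    by (auto simp: space_restrict_space)
  have P_eq: "P \<omega> = ?g (I \<omega>)" if "\<omega> \<in> ?\<Omega>" for \<omega>
    using that assms(6,7) by (simp add: solar_power_def)
  \<comment> \<open>Measurability of \<open>P\<close> is not assumed; it is inherited from the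
    composite of \<open>?g\<close> and \<open>I\<close>, with which \<open>P\<close> agrees on the
    restricted space.\<close>
  have "(\<lambda>\<omega>. ?g (I \<omega>)) \<in> measurable ?M ?N"
    using assms(2,3) by (intro measurable_restrict_space2 measurable_restrict_space1)
      (auto simp: space_M intro!: solar_power_pos)
  then have P [measurable]: "P \<in> measurable ?M ?N"
    by (rule measurable_cong[THEN iffD1, rotated]) (simp add: space_M P_eq)
  have S [measurable]: "?S \<in> borel_measurable ?N"
    by (intro measurable_restrict_space1) measurable
  have "distr ?M ?N P = density ?N ?S"
  proof (rule measure_eqI)
    fix A assume "A \<in> sets (distr ?M ?N P)"
    then have A: "A \<in> sets ?N"
      by simp
    then have A_pos: "A \<subseteq> {0<..}" and [measurable]: "A \<in> sets borel"
      by (auto simp: sets_restrict_space)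
    \<comment> \<open>On the event \<open>I > 0\<close>, \<open>P\<close> lies in \<open>A\<close>
      exactly when \<open>I\<close> lies in \<open>B\<close>, so the probability can be computed
      from the law of \<open>I\<close> alone.\<close>
    define B where "B = {x. 0 < x \<and> ?g x \<in> A}"
    have [measurable]: "B \<in> sets borel"
      unfolding B_def by measurable
    have "emeasure (distr ?M ?N P) A = emeasure ?M (P -` A \<inter> space ?M)"
      using A by (simp add: emeasure_distr)
    also have "P -` A \<inter> space ?M = I -` B \<inter> space M"
      by (auto simp: space_M B_def P_eq)
    also have "emeasure ?M (I -` B \<inter> space M) = emeasure M (I -` B \<inter> space M)"
      using \<Omega> by (intro emeasure_restrict_space) (auto simp: B_def)
    also have "\<dots> = (\<integral>\<^sup>+x. ennreal (normal_density I\<^sub>d 1 x) * indicator B x \<partial>lborel)"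
      using assms(5) by (rule distributed_emeasure) simp
    also have "\<dots> = (\<integral>\<^sup>+x. indicator A (?g x) * ennreal (normal_density I\<^sub>d 1 x) *
        indicator {0<..} x \<partial>lborel)"
      by (intro nn_integral_cong) (auto simp: B_def indicator_def)
    \<comment> \<open>Change of variables with \<open>H = indicator A\<close>.\<close>
    also have "\<dots> = (\<integral>\<^sup>+p. indicator A p * ?S p * indicator {0<..} p \<partial>lborel)"
      using assms(2,3) by (intro nn_integral_solar_power[symmetric]) auto
    also have "\<dots> = (\<integral>\<^sup>+p. ?S p * indicator A p \<partial>?N)"
      by (simp add: nn_integral_restrict_space mult.commute)
    also have "\<dots> = emeasure (density ?N ?S) A"
      using A by (simp add: emeasure_density)
    finally show "emeasure (distr ?M ?N P) A = emeasure (density ?N ?S) A" .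
  qed simp
  then show ?thesis
    unfolding distributed_def using P S by blast
qed

end
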